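(* There is a constant $D>0$ such that the following holds. Let $G$ be any finite graph with $n\ge 2$ vertices and maximum degree $\Delta$, let $q\ge\Delta+2$, and consider the self-organizing network coloring game on $G$ with $q$ colors in which all players use the greedy and selfish strategy. Let $T$ be the number of rounds until all players have payoff $1$. Then, whatever the initial state, $\operatorname{Var}(T)\le D(\log n)^2$; that is, $\operatorname{Var}(T)=O((\log n)^2)$.
   Context: Network coloring game: players are the vertices $1,\dots,n$ of $G$; $N(i)$ denotes the neighbours of $i$. There are $q$ colors. In discrete rounds $t=0,1,2,\dots$ each player $i$ holds a color $l_i(t)$ and has payoff $U_i(t)=1$ if $l_i(t)\ne l_j(t)$ for all $j\in N(i)$ and $U_i(t)=0$ otherwise. Greedy and selfish strategy: a player with payoff $1$ keeps its color; a player with payoff $0$ chooses its next color uniformly at random among the colors not used by any of its neighbours in the previous round, independently of the other players. The game has converged once all payoffs equal $1$. *)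

theory Defs
  imports "HOL-Probability.Probability"
begin

text \<open>
  Players are \<open>1, \<dots>, n\<close> and colours are \<open>1, \<dots>, q\<close>. A graph on the players is given by its
  symmetric, irreflexive adjacency relation.
\<close>

definition graph_on :: "nat \<Rightarrow> (nat \<times> nat) set \<Rightarrow> bool" where
  "graph_on n E \<longleftrightarrow> E \<subseteq> {1..n} \<times> {1..n} \<and> sym E \<and> irrefl E"

definition neighbours :: "(nat \<times> nat) set \<Rightarrow> nat \<Rightarrow> nat set" where
  "neighbours E i = E `` {i}"

definition max_degree :: "nat \<Rightarrow> (nat \<times> nat) set \<Rightarrow> nat" where
  "max_degree n E = Max ((\<lambda>i. card (neighbours E i)) ` {1..n})"

text \<open>A state \<open>l\<close> assigns a colour to each player; its values outside \<open>{1..n}\<close> play no role.\<close>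

type_synonym state = "nat \<Rightarrow> nat"

definition payoff :: "(nat \<times> nat) set \<Rightarrow> state \<Rightarrow> nat \<Rightarrow> nat" where
  "payoff E l i = (if \<forall>j\<in>neighbours E i. l i \<noteq> l j then 1 else 0)"

definition available :: "(nat \<times> nat) set \<Rightarrow> nat \<Rightarrow> state \<Rightarrow> nat \<Rightarrow> nat set" where
  "available E q l i = {1..q} - l ` neighbours E i"

definition next_colour :: "(nat \<times> nat) set \<Rightarrow> nat \<Rightarrow> state \<Rightarrow> nat \<Rightarrow> nat pmf" where
  "next_colour E q l i =
     (if payoff E l i = 1 then return_pmf (l i) else pmf_of_set (available E q l i))"

definition next_state :: "nat \<Rightarrow> (nat \<times> nat) set \<Rightarrow> nat \<Rightarrow> state \<Rightarrow> state pmf" where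
  "next_state n E q l = Pi_pmf {1..n} 0 (next_colour E q l)"

text \<open>
  The law of the whole play \<open>l(0), l(1), l(2), \<dots>\<close> started in the state \<open>l0\<close> is the
  Ionescu-Tulcea measure on \<open>nat \<Rightarrow> state\<close> in which, given the history \<open>\<omega>\<close> before round \<open>t\<close>,
  the state in round \<open>t\<close> is distributed according to \<open>game_kernel n E q l0 t \<omega>\<close>.
\<close>

definition game_kernel ::
    "nat \<Rightarrow> (nat \<times> nat) set \<Rightarrow> nat \<Rightarrow> state \<Rightarrow> nat \<Rightarrow> (nat \<Rightarrow> state) \<Rightarrow> state measure" where
  "game_kernel n E q l0 t \<omega> =
     measure_pmf (case t of 0 \<Rightarrow> return_pmf l0 | Suc s \<Rightarrow> next_state n E q (\<omega> s))"

lemma Ionescu_Tulcea_game: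
  "Ionescu_Tulcea (game_kernel n E q l0) (\<lambda>_. count_space UNIV)"
proof (rule Ionescu_Tulcea.intro)
  fix i
  show "game_kernel n E q l0 i \<in>
      measurable (PiM {0..<i} (\<lambda>_. count_space UNIV)) (subprob_algebra (count_space UNIV))"
  proof (cases i)
    case 0
    then show ?thesis
      by (auto simp: game_kernel_def[abs_def] intro!: measurable_const measure_pmf_in_subprob_algebra)
  next
    case (Suc s)
    have "(\<lambda>\<omega>. \<omega> s) \<in>
        measurable (PiM {0..<i} (\<lambda>_. count_space (UNIV :: state set))) (count_space UNIV)"
      using Suc by (intro measurable_component_singleton) auto
    moreover have "(\<lambda>l. measure_pmf (next_state n E q l)) \<in>
        measurable (count_space UNIV) (subprob_algebra (count_space UNIV))"
      by (auto intro: measure_pmf_in_subprob_algebra)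
    ultimately have "(\<lambda>\<omega>. measure_pmf (next_state n E q (\<omega> s))) \<in>
        measurable (PiM {0..<i} (\<lambda>_. count_space UNIV)) (subprob_algebra (count_space UNIV))"
      by (rule measurable_compose)
    then show ?thesis
      using Suc by (simp add: game_kernel_def[abs_def])
  qed
qed (simp add: game_kernel_def measure_pmf.prob_space_axioms)

definition game_measure ::
    "nat \<Rightarrow> (nat \<times> nat) set \<Rightarrow> nat \<Rightarrow> state \<Rightarrow> (nat \<Rightarrow> state) measure" where
  "game_measure n E q l0 =
     projective_family.lim UNIV
       (Ionescu_Tulcea.CI (game_kernel n E q l0) (\<lambda>_. count_space UNIV)) (\<lambda>_. count_space UNIV)"

lemma sets_game_measure:
  "sets (game_measure n E q l0) = sets (PiM UNIV (\<lambda>_. count_space UNIV))"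
proof -
  interpret Ionescu_Tulcea "game_kernel n E q l0" "\<lambda>_. count_space UNIV"
    by (rule Ionescu_Tulcea_game)
  show ?thesis
    unfolding game_measure_def by (rule PF.sets_lim)
qed

lemma space_game_measure: "space (game_measure n E q l0) = UNIV"
  using sets_eq_imp_space_eq[OF sets_game_measure] by (simp add: space_PiM)

lemma emeasure_game_measure_path:
  "emeasure (game_measure n E q l0) {\<omega>. \<forall>s\<le>t. \<omega> s = x s} =
     ennreal ((if x 0 = l0 then 1 else 0) * (\<Prod>s<t. pmf (next_state n E q (x s)) (x (Suc s))))"
proof -
  let ?M = "\<lambda>_ :: nat. count_space (UNIV :: state set)"
  let ?K = "game_kernel n E q l0"
  interpret Ionescu_Tulcea ?K ?M
    by (rule Ionescu_Tulcea_game)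
  let ?S = "\<lambda>m. PiE {0..<m} (\<lambda>i. {x i})"
  have S[measurable]: "?S m \<in> sets (PiM {0..<m} ?M)" for m
    by (intro sets_PiM_I_finite) auto
  have C: "emeasure (C 0 m (\<lambda>_. undefined)) (?S m) = (\<Prod>s<m. emeasure (?K s x) {x s})" for m
  proof (induction m)
    case 0
    then show ?case by (simp add: PiM_empty)
  next
    case (Suc m)
    have u: "(\<lambda>_. undefined) \<in> space (PiM {0..<0} ?M)"
      by (simp add: space_PiM)
    have "emeasure (C 0 (Suc m) (\<lambda>_. undefined)) (?S (Suc m)) =
        (\<integral>\<^sup>+ \<omega>. emeasure (eP m \<omega>) (?S (Suc m)) \<partial>C 0 m (\<lambda>_. undefined))"
      using measurable_eP[of m] measurable_C[of 0 m] prob_space_C[OF u, of m]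
      by (simp add: emeasure_bind[where N = "PiM {0..<Suc m} ?M"] sets_C[OF u]
            measurable_cong_sets[OF sets_C[OF u] refl] prob_space.not_empty)
    also have "\<dots> = (\<integral>\<^sup>+ \<omega>. emeasure (?K m x) {x m} * indicator (?S m) \<omega> \<partial>C 0 m (\<lambda>_. undefined))"
    proof (rule nn_integral_cong)
      fix \<omega> assume "\<omega> \<in> space (C 0 m (\<lambda>_. undefined))"
      then have \<omega>: "\<omega> \<in> space (PiM {0..<m} ?M)"
        by (simp add: space_C[OF u])
      then have ext: "\<omega> \<in> extensional {0..<m}"
        by (simp add: space_PiM PiE_iff)
      have "fun_upd \<omega> m -` ?S (Suc m) = (if \<omega> \<in> ?S m then {x m} else {})"
        using ext by (auto simp: PiE_iff extensional_def less_Suc_eq split: if_splits)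
      moreover have "?K m \<omega> = ?K m x" if "\<omega> \<in> ?S m"
        using that by (cases m) (auto simp: game_kernel_def PiE_iff)
      ultimately show "emeasure (eP m \<omega>) (?S (Suc m)) = emeasure (?K m x) {x m} * indicator (?S m) \<omega>"
        using emeasure_eP[OF \<omega> S] by (auto split: split_indicator)
    qed
    also have "\<dots> = emeasure (?K m x) {x m} * emeasure (C 0 m (\<lambda>_. undefined)) (?S m)"
      by (intro nn_integral_cmult_indicator) (simp add: sets_C[OF u])
    finally show ?case
      using Suc by (simp add: mult.commute)
  qed
  have emb: "PF.emb {0..<m} {0..<m} (?S m) = ?S m" for m
    by (rule prod_emb_id) auto
  have "{\<omega>. \<forall>s\<le>t. \<omega> s = x s} = PF.emb UNIV {0..<Suc t} (?S (Suc t))"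
    by (auto simp: prod_emb_def PiE_iff)
  then have "emeasure (game_measure n E q l0) {\<omega>. \<forall>s\<le>t. \<omega> s = x s} =
      emeasure (C 0 (Suc t) (\<lambda>_. undefined)) (?S (Suc t))"
    unfolding game_measure_def
    by (simp only: lim[OF finite_atLeastLessThan S] emeasure_CI[OF order_refl S] emb)
  also have "\<dots> = (\<Prod>s<Suc t. emeasure (?K s x) {x s})"
    by (rule C)
  also have "\<dots> = emeasure (?K 0 x) {x 0} * (\<Prod>s<t. emeasure (?K (Suc s) x) {x (Suc s)})"
    by (rule prod.lessThan_Suc_shift)
  also have "\<dots> = ennreal ((if x 0 = l0 then 1 else 0) *
      (\<Prod>s<t. pmf (next_state n E q (x s)) (x (Suc s))))"
    by (auto simp: game_kernel_def emeasure_pmf_single prod_ennreal prod_nonneg)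
  finally show ?thesis .
qed

lemma prob_space_game_measure: "prob_space (game_measure n E q l0)"
proof -
  interpret Ionescu_Tulcea "game_kernel n E q l0" "\<lambda>_. count_space UNIV"
    by (rule Ionescu_Tulcea_game)
  interpret P: prob_space "CI {}"
    by (rule PF.prob_space_P) auto
  have "emeasure PF.lim (PF.emb UNIV {} (space (PiM {} (\<lambda>_. count_space UNIV)))) = 1"
    using P.emeasure_space_1 by (subst lim) (auto simp: CI_def)
  moreover have "PF.emb UNIV {} (space (PiM {} (\<lambda>_. count_space UNIV))) = space PF.lim"
    by (auto simp: prod_emb_def PF.space_lim space_PiM restrict_def)
  ultimately show ?thesis
    unfolding game_measure_def by (intro prob_spaceI) metis
qed

definition converged :: "nat \<Rightarrow> (nat \<times> nat) set \<Rightarrow> state \<Rightarrow> bool" where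
  "converged n E l \<longleftrightarrow> (\<forall>i\<in>{1..n}. payoff E l i = 1)"

text \<open>
  \<open>LEAST\<close> is unspecified on plays that never converge, so the value is only meaningful together
  with almost sure convergence.
\<close>

definition convergence_time :: "nat \<Rightarrow> (nat \<times> nat) set \<Rightarrow> (nat \<Rightarrow> state) \<Rightarrow> nat" where
  "convergence_time n E \<omega> = (LEAST t. converged n E (\<omega> t))"

end

theory Submission
  imports Defs
begin

text \<open>
  A player with payoff 1 keeps it forever. Let player \<open>i\<close> have \<open>u\<close> neighbours with payoff 0. If
  \<open>i\<close> chooses among \<open>a\<close> colours, Jensen's inequality shows that it obtains payoff 1 in the next
  round with probability at least \<open>exp (- 2 u / a)\<close>. Here \<open>a\<close> may be much smaller than \<open>u\<close>, but
  only for one round: of the at least \<open>u + 2\<close> colours not held by a neighbour with payoff 1, the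
  expected fraction left unused by the random choices of the other \<open>u\<close> neighbours is at least
  \<open>exp (- 2)\<close>. Hence from every state, a player has payoff 1 two rounds later with probability at
  least a universal constant. So the probability that the game has not converged at time \<open>t\<close> is at
  most \<open>n\<close> times a geometric sequence in \<open>t\<close>, and \<open>Var T\<close> is at most the second moment of \<open>T\<close>,
  which is of order \<open>(log n)\<^sup>2\<close>.
\<close>

section \<open>Probability mass functions and elementary inequalities\<close>

lemma integrable_measure_pmf_indicator: "integrable (measure_pmf p) (indicat_real X)"
  by (auto intro!: integrable_real_indicator simp: measure_pmf.emeasure_eq_measure)

lemma integrable_measure_pmf_prob:
  "integrable (measure_pmf p) (\<lambda>x. measure_pmf.prob (f x) X)"
  by (intro measure_pmf.integrable_const_bound[where B = 1]) auto

lemma measure_bind_pmf_eq_integral: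
  "measure_pmf.prob (bind_pmf p f) X = (\<integral>x. measure_pmf.prob (f x) X \<partial>measure_pmf p)"
proof -
  have "ennreal (measure_pmf.prob (bind_pmf p f) X) = (\<integral>\<^sup>+x. ennreal (measure_pmf.prob (f x) X) \<partial>p)"
    by (simp flip: measure_pmf.emeasure_eq_measure)
  also have "\<dots> = ennreal (\<integral>x. measure_pmf.prob (f x) X \<partial>measure_pmf p)"
    by (intro nn_integral_eq_integral integrable_measure_pmf_prob) auto
  finally show ?thesis
    by (simp add: ennreal_inj)
qed

lemma prob_Compl_singleton: "measure_pmf.prob p (- {x}) = 1 - pmf p x"
  using measure_pmf.prob_compl[of "{x}" p] by (simp add: Compl_eq_Diff_UNIV measure_pmf_single)

text \<open>On \<open>[0, 1/2]\<close> the logarithmic bound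
  \<open>- p - 2 * p^2 <= ln (1 - p)\<close> can be weakened to the linear \<open>- 2 * p\<close>,
  because \<open>2 * p^2 <= p\<close> there.\<close>

lemma one_minus_ge_exp:
  fixes p :: real
  assumes "0 \<le> p" "p \<le> 1/2"
  shows "exp (- (2 * p)) \<le> 1 - p"
proof -
  have "2 * p\<^sup>2 \<le> p"
    using mult_left_mono[OF assms(2,1)] by (simp add: power2_eq_square)
  then have "- (2 * p) \<le> ln (1 - p)"
    using ln_one_minus_pos_lower_bound[OF assms] by linarith
  then show ?thesis
    using assms by (simp add: ln_ge_iff)
qed

text \<open>Jensen's inequality for \<open>exp\<close>, obtained from the tangent line at \<open>- (2 * u / card X)\<close>.\<close>

lemma sum_prod_one_minus_ge:
  fixes p :: "'j \<Rightarrow> 'x \<Rightarrow> real"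
  assumes X: "finite X" "X \<noteq> {}" and "finite N"
    and p: "\<And>j x. j \<in> N \<Longrightarrow> x \<in> X \<Longrightarrow> 0 \<le> p j x \<and> p j x \<le> 1/2"
    and u: "(\<Sum>x\<in>X. \<Sum>j\<in>N. p j x) \<le> u"
  shows "card X * exp (- (2 * u / card X)) \<le> (\<Sum>x\<in>X. \<Prod>j\<in>N. 1 - p j x)"
proof -
  define m where "m = 2 * u / card X"
  define s where "s x = (\<Sum>j\<in>N. 2 * p j x)" for x
  have card: "real (card X) > 0"
    using X by (simp add: card_gt_0_iff)
  have "(\<Sum>x\<in>X. s x) = 2 * (\<Sum>x\<in>X. \<Sum>j\<in>N. p j x)"
    by (simp add: s_def sum_distrib_left)
  also have "\<dots> \<le> card X * m"
    using u card by (simp add: m_def)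
  finally have s: "(\<Sum>x\<in>X. s x) \<le> card X * m" .
  \<comment> \<open>The bracket is \<open>card X\<close> plus a nonnegative slack, and it is also
    the sum over \<open>X\<close> of the tangent-line factors \<open>1 + (m - s x)\<close>.\<close>
  have "card X * exp (- m) \<le> exp (- m) * (card X + card X * m - (\<Sum>x\<in>X. s x))"
    using s mult_left_mono[of "card X" "card X + card X * m - (\<Sum>x\<in>X. s x)" "exp (- m)"]
    by (simp add: mult.commute)
  also have "\<dots> = (\<Sum>x\<in>X. exp (- m) * (1 + (m - s x)))"
    by (simp flip: sum_distrib_left add: sum.distrib sum_subtractf)
  also have "\<dots> \<le> (\<Sum>x\<in>X. exp (- m) * exp (m - s x))"
    by (intro sum_mono mult_left_mono exp_ge_add_one_self) auto
  also have "\<dots> = (\<Sum>x\<in>X. \<Prod>j\<in>N. exp (- (2 * p j x)))"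
    by (intro sum.cong) (auto simp: s_def exp_sum[symmetric] \<open>finite N\<close> sum_negf simp flip: exp_add)
  also have "\<dots> \<le> (\<Sum>x\<in>X. \<Prod>j\<in>N. 1 - p j x)"
    using p by (intro sum_mono prod_mono) (auto intro: one_minus_ge_exp)
  finally show ?thesis
    by (simp add: m_def)
qed

section \<open>From a geometric tail to a logarithmic variance bound\<close>

text \<open>The quadratic moment is compared with an exponential one, centred at \<open>ln x / ln b\<close>.\<close>

lemma square_le_exponential:
  fixes b x :: real
  assumes b: "b > 1" and x: "x \<ge> 1"
  shows "(real k)\<^sup>2 \<le> 2 * (ln x / ln b)\<^sup>2 + 4 / (ln b)\<^sup>2 * (b ^ k / x)"
proof -
  define L where "L = ln b"
  define m where "m = ln x / L"
  have L: "L > 0" and m: "m \<ge> 0"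
    using b x by (auto simp: L_def m_def)
  show ?thesis
  proof (cases "real k \<le> m")
    case True
    then have "(real k)\<^sup>2 \<le> m\<^sup>2"
      by (intro power_mono) auto
    moreover have "0 \<le> m\<^sup>2" "0 \<le> 4 / L\<^sup>2 * (b ^ k / x)"
      using b x by auto
    ultimately show ?thesis
      unfolding L_def[symmetric] m_def[symmetric] by linarith
  next
    case False
    \<comment> \<open>\<open>z\<close> is scaled so that \<open>exp z\<close> equals
      \<open>b ^ k / x\<close>; being nonnegative, it satisfies
      \<open>z^2 / 2 <= exp z\<close>.\<close>
    define z where "z = (real k - m) * L"
    have z: "z \<ge> 0"
      using False L by (simp add: z_def)
    have "z\<^sup>2 / 2 \<le> exp z"
      using exp_lower_Taylor_quadratic[OF z] z by linarith
    also have "exp z = exp (real k * L) / exp (ln x)"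
      using L by (simp add: z_def m_def algebra_simps exp_diff)
    also have "\<dots> = b ^ k / x"
      using b x by (simp add: L_def exp_of_nat_mult)
    finally have "(real k - m)\<^sup>2 * L\<^sup>2 \<le> 2 * (b ^ k / x)"
      by (simp add: z_def power_mult_distrib mult.commute)
    then have "(real k - m)\<^sup>2 \<le> 2 * (b ^ k / x) / L\<^sup>2"
      using L by (simp only: pos_le_divide_eq zero_less_power)
    \<comment> \<open>The difference of the two sides is \<open>(real k - 2 * m)^2\<close>.\<close>
    moreover have "(real k)\<^sup>2 \<le> 2 * m\<^sup>2 + 2 * (real k - m)\<^sup>2"
      using sum_squares_ge_zero[of "real k - 2 * m" 0] by (simp add: power2_eq_square algebra_simps)
    moreover have "2 * (2 * (b ^ k / x) / L\<^sup>2) = 4 / L\<^sup>2 * (b ^ k / x)"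
      by simp
    ultimately show ?thesis
      unfolding L_def[symmetric] m_def[symmetric] by linarith
  qed
qed

text \<open>A discrete layer-cake argument. The tail decays like \<open>s ^ (2 * t)\<close> while
  the weights \<open>(1 / s) ^ t\<close> undo only half of this decay, so the products form a
  geometric series of ratio \<open>s\<close>. Writing the tail rate as a square leaves exactly this
  room.\<close>

lemma nn_integral_exponential_le:
  assumes "prob_space M" and T[measurable]: "T \<in> measurable M (count_space UNIV)"
    and s: "0 < s" "s < 1" and C: "C \<ge> 0"
    and tail: "\<And>t. measure M {\<omega> \<in> space M. t < T \<omega>} \<le> C * (s\<^sup>2) ^ t"
  shows "(\<integral>\<^sup>+\<omega>. ennreal ((1 / s) ^ T \<omega>) \<partial>M) \<le> ennreal (1 + C / s)"
proof -
  interpret prob_space M by fact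
  define b where "b = 1 / s"
  have b: "b > 1" "b - 1 \<ge> 0"
    using s by (auto simp: b_def)
  \<comment> \<open>\<open>b ^ k - 1\<close> is the telescoping sum of the increments
    \<open>(b - 1) * b ^ t\<close> for \<open>t < k\<close>; as a series with indicators it can be
    integrated term by term against the tail events.\<close>
  have pt: "ennreal (b ^ k) = 1 + (\<Sum>t. ennreal ((b - 1) * b ^ t) * (if t < k then 1 else 0))" for k
  proof -
    have "(\<Sum>t. ennreal ((b - 1) * b ^ t) * (if t < k then 1 else 0)) =
        (\<Sum>t<k. ennreal ((b - 1) * b ^ t) * (if t < k then 1 else 0))"
      by (intro suminf_finite) auto
    also have "\<dots> = ennreal (\<Sum>t<k. (b - 1) * b ^ t)"
      using b by (simp add: sum_ennreal)
    also have "(\<Sum>t<k. (b - 1) * b ^ t) = b ^ k - 1"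
      by (induction k) (auto simp: algebra_simps)
    also have "1 + ennreal (b ^ k - 1) = ennreal (b ^ k)"
      using b by (simp flip: ennreal_1 ennreal_plus)
    finally show ?thesis by simp
  qed
  have "(\<integral>\<^sup>+\<omega>. ennreal (b ^ T \<omega>) \<partial>M) =
      (\<integral>\<^sup>+\<omega>. 1 + (\<Sum>t. ennreal ((b - 1) * b ^ t) * indicator {\<omega> \<in> space M. t < T \<omega>} \<omega>) \<partial>M)"
    by (intro nn_integral_cong) (auto simp: pt indicator_def intro!: arg_cong[where f = suminf])
  also have "\<dots> = 1 + (\<Sum>t. \<integral>\<^sup>+\<omega>. ennreal ((b - 1) * b ^ t) * indicator {\<omega> \<in> space M. t < T \<omega>} \<omega> \<partial>M)"
    by (simp add: nn_integral_add nn_integral_suminf emeasure_space_1)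
  also have "\<dots> = 1 + (\<Sum>t. ennreal ((b - 1) * b ^ t * prob {\<omega> \<in> space M. t < T \<omega>}))"
    using b by (simp add: nn_integral_cmult_indicator emeasure_eq_measure ennreal_mult)
  also have "\<dots> \<le> 1 + (\<Sum>t. ennreal ((b - 1) * C * s ^ t))"
  proof (intro add_left_mono suminf_le ennreal_leI)
    fix t
    have "(b - 1) * b ^ t * prob {\<omega> \<in> space M. t < T \<omega>} \<le> (b - 1) * b ^ t * (C * (s\<^sup>2) ^ t)"
      using b by (intro mult_left_mono tail) auto
    also have "\<dots> = (b - 1) * C * s ^ t"
      using s by (simp add: b_def power2_eq_square power_mult_distrib field_simps)
    finally show "(b - 1) * b ^ t * prob {\<omega> \<in> space M. t < T \<omega>} \<le> (b - 1) * C * s ^ t" .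
  qed auto
  also have "(\<Sum>t. ennreal ((b - 1) * C * s ^ t)) = ennreal ((b - 1) * C * (1 / (1 - s)))"
    using s b C geometric_sums[of s]
    by (intro suminf_ennreal_eq sums_mult) auto
  also have "1 + \<dots> = ennreal (1 + C / s)"
  proof -
    have "(b - 1) * C * (1 / (1 - s)) = C / s"
      using s by (simp add: b_def divide_simps)
    then show ?thesis
      using s C by (simp flip: ennreal_1 ennreal_plus)
  qed
  finally show ?thesis by (simp add: b_def)
qed

text \<open>The variance is at most the second moment. Centring at \<open>ln x / ln b\<close>
  divides the exponential moment by \<open>x\<close>, which cancels the factor \<open>x\<close> of
  the tail bound and leaves a constant. In the application \<open>x\<close> is the number of
  players.\<close>

lemma variance_le_log_square:
  fixes x :: real
  assumes "prob_space M" and T[measurable]: "T \<in> measurable M (count_space (UNIV :: nat set))"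
    and s: "0 < s" "s < 1" and C: "C \<ge> 0" and x: "x \<ge> 2"
    and tail: "\<And>t. measure M {\<omega> \<in> space M. t < T \<omega>} \<le> C * x * (s\<^sup>2) ^ t"
  shows "integrable M (\<lambda>\<omega>. real (T \<omega>))" "integrable M (\<lambda>\<omega>. (real (T \<omega>))\<^sup>2)"
    "prob_space.variance M (\<lambda>\<omega>. real (T \<omega>)) \<le>
       (2 / (ln s)\<^sup>2 + 4 / (ln s)\<^sup>2 * (1 + C / s) / (ln 2)\<^sup>2) * (ln x)\<^sup>2"
proof -
  interpret prob_space M by fact
  define b where "b = 1 / s"
  have b: "b > 1" and lnb: "(ln b)\<^sup>2 = (ln s)\<^sup>2" and lns: "(ln s)\<^sup>2 > 0"
    using s by (auto simp: b_def ln_div)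
  define K where "K = 2 * (ln x / ln b)\<^sup>2 + 4 / (ln s)\<^sup>2 * (1 + C / s)"
  have "(\<integral>\<^sup>+\<omega>. ennreal ((real (T \<omega>))\<^sup>2) \<partial>M) \<le>
      (\<integral>\<^sup>+\<omega>. ennreal (2 * (ln x / ln b)\<^sup>2) + ennreal (4 / (ln s)\<^sup>2 / x) * ennreal (b ^ T \<omega>) \<partial>M)"
  proof (rule nn_integral_mono)
    fix \<omega>
    have "(real (T \<omega>))\<^sup>2 \<le> 2 * (ln x / ln b)\<^sup>2 + 4 / (ln s)\<^sup>2 / x * b ^ T \<omega>"
      using square_le_exponential[OF b, of x "T \<omega>"] x by (simp add: lnb)
    then show "ennreal ((real (T \<omega>))\<^sup>2) \<le>
        ennreal (2 * (ln x / ln b)\<^sup>2) + ennreal (4 / (ln s)\<^sup>2 / x) * ennreal (b ^ T \<omega>)"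
      using b x by (simp flip: ennreal_plus ennreal_mult)
  qed
  also have "\<dots> = ennreal (2 * (ln x / ln b)\<^sup>2) +
      ennreal (4 / (ln s)\<^sup>2 / x) * (\<integral>\<^sup>+\<omega>. ennreal (b ^ T \<omega>) \<partial>M)"
    by (simp add: nn_integral_add nn_integral_cmult emeasure_space_1)
  also have "\<dots> \<le> ennreal (2 * (ln x / ln b)\<^sup>2) + ennreal (4 / (ln s)\<^sup>2 / x) * ennreal (1 + C * x / s)"
    using nn_integral_exponential_le[OF \<open>prob_space M\<close> T s _ tail] C x
    by (intro add_left_mono mult_left_mono) (auto simp: b_def)
  also have "\<dots> = ennreal (2 * (ln x / ln b)\<^sup>2 + 4 / (ln s)\<^sup>2 / x * (1 + C * x / s))"
    using s C x by (simp flip: ennreal_plus ennreal_mult)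
  also have "\<dots> \<le> ennreal K"
  proof -
    have "4 / (ln s)\<^sup>2 / x * (1 + C * x / s) = 4 / (ln s)\<^sup>2 * (1 / x + C / s)"
      using x by (simp add: field_simps)
    also have "\<dots> \<le> 4 / (ln s)\<^sup>2 * (1 + C / s)"
      using x by (intro mult_left_mono) auto
    finally show ?thesis
      by (intro ennreal_leI) (simp add: K_def)
  qed
  finally have le: "(\<integral>\<^sup>+\<omega>. ennreal ((real (T \<omega>))\<^sup>2) \<partial>M) \<le> ennreal K" .
  then have "(\<integral>\<^sup>+\<omega>. ennreal ((real (T \<omega>))\<^sup>2) \<partial>M) < \<infinity>"
    by (rule order_le_less_trans) simp
  then show int2: "integrable M (\<lambda>\<omega>. (real (T \<omega>))\<^sup>2)"
    by (intro integrableI_bounded) auto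
  then show int1: "integrable M (\<lambda>\<omega>. real (T \<omega>))"
    by (rule square_integrable_imp_integrable[rotated]) auto
  have K0: "0 \<le> K"
    using s C by (auto simp: K_def intro!: add_nonneg_nonneg mult_nonneg_nonneg)
  have "variance (\<lambda>\<omega>. real (T \<omega>)) \<le> expectation (\<lambda>\<omega>. (real (T \<omega>))\<^sup>2)"
    by (subst variance_eq[OF int1 int2]) simp
  also have "\<dots> \<le> K"
    using le K0 by (subst (asm) nn_integral_eq_integral[OF int2]) auto
  also have "K \<le> (2 / (ln s)\<^sup>2 + 4 / (ln s)\<^sup>2 * (1 + C / s) / (ln 2)\<^sup>2) * (ln x)\<^sup>2"
  proof -
    \<comment> \<open>As \<open>x >= 2\<close>, the additive constant is absorbed into a multiple of
      \<open>(ln x)^2\<close>.\<close>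
    have "(ln 2)\<^sup>2 \<le> (ln x)\<^sup>2"
      using x by (intro power_mono) auto
    then have "4 / (ln s)\<^sup>2 * (1 + C / s) * 1 \<le> 4 / (ln s)\<^sup>2 * (1 + C / s) * ((ln x)\<^sup>2 / (ln 2)\<^sup>2)"
      using s C by (intro mult_left_mono) auto
    then show ?thesis
      by (simp add: K_def power_divide lnb algebra_simps)
  qed
  finally show "variance (\<lambda>\<omega>. real (T \<omega>)) \<le>
       (2 / (ln s)\<^sup>2 + 4 / (ln s)\<^sup>2 * (1 + C / s) / (ln 2)\<^sup>2) * (ln x)\<^sup>2" .
qed

section \<open>Law of the state at a fixed time\<close>

primrec state_law :: "nat \<Rightarrow> (nat \<times> nat) set \<Rightarrow> nat \<Rightarrow> state \<Rightarrow> nat \<Rightarrow> state pmf" where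
  "state_law n E q l0 0 = return_pmf l0"
| "state_law n E q l0 (Suc t) = bind_pmf (state_law n E q l0 t) (next_state n E q)"

text \<open>Reduces events about a single round of the infinite play to a pmf, where rounds can be
  composed by \<open>bind_pmf\<close>. The event is a cylinder, so its measure is computed at the
  finite stage \<open>C 0 (Suc t)\<close> of the Ionescu-Tulcea construction.\<close>

lemma emeasure_game_measure_state:
  "emeasure (game_measure n E q l0) {\<omega>. \<omega> t \<in> A} = emeasure (measure_pmf (state_law n E q l0 t)) A"
proof -
  let ?M = "\<lambda>_ :: nat. count_space (UNIV :: state set)"
  let ?K = "game_kernel n E q l0"
  interpret Ionescu_Tulcea ?K ?M
    by (rule Ionescu_Tulcea_game)
  let ?u = "\<lambda>_ :: nat. undefined :: state"
  let ?S = "\<lambda>t A. PiE {0..<Suc t} (\<lambda>i. if i = t then A else UNIV)"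
  have u: "?u \<in> space (PiM {0..<0} ?M)"
    by (simp add: space_PiM)
  have S[measurable]: "?S t A \<in> sets (PiM {0..<Suc t} ?M)" for t A
    by (intro sets_PiM_I_finite) auto
  have C: "emeasure (C 0 (Suc t) ?u) (?S t A) = (\<integral>\<^sup>+ \<omega>. emeasure (?K t \<omega>) A \<partial>C 0 t ?u)" for t A
  proof -
    have "emeasure (C 0 (Suc t) ?u) (?S t A) = (\<integral>\<^sup>+ \<omega>. emeasure (eP t \<omega>) (?S t A) \<partial>C 0 t ?u)"
      using measurable_eP[of t] measurable_C[of 0 t] prob_space_C[OF u, of t]
      by (simp add: emeasure_bind[where N = "PiM {0..<Suc t} ?M"] sets_C[OF u]
            measurable_cong_sets[OF sets_C[OF u] refl] prob_space.not_empty)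
    also have "\<dots> = (\<integral>\<^sup>+ \<omega>. emeasure (?K t \<omega>) A \<partial>C 0 t ?u)"
    proof (rule nn_integral_cong)
      fix \<omega> assume "\<omega> \<in> space (C 0 t ?u)"
      then have \<omega>: "\<omega> \<in> space (PiM {0..<t} ?M)"
        by (simp add: space_C[OF u])
      then have ext: "\<omega> \<in> extensional {0..<t}"
        by (simp add: space_PiM PiE_iff)
      \<comment> \<open>Only the newest coordinate is constrained, so every history is extended by
        exactly the states in \<open>A\<close>.\<close>
      have "fun_upd \<omega> t -` ?S t A = A"
        using ext by (auto simp: PiE_iff extensional_def less_Suc_eq split: if_splits)
      then show "emeasure (eP t \<omega>) (?S t A) = emeasure (?K t \<omega>) A"
        using emeasure_eP[OF \<omega> S] by auto
    qed
    finally show ?thesis .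
  qed
  have meas[measurable]: "(\<lambda>\<omega>. \<omega> t) \<in> measurable (C 0 (Suc t) ?u) (count_space UNIV)" for t
    unfolding measurable_cong_sets[OF sets_C[OF u] refl]
    using measurable_component_singleton[of t "{0..<0 + Suc t}" ?M] by simp
  have distr: "emeasure (distr (C 0 (Suc t) ?u) (count_space UNIV) (\<lambda>\<omega>. \<omega> t)) A =
      (\<integral>\<^sup>+ \<omega>. emeasure (?K t \<omega>) A \<partial>C 0 t ?u)" for t A
  proof -
    have "(\<lambda>\<omega>. \<omega> t) -` A \<inter> space (C 0 (Suc t) ?u) = ?S t A"
      unfolding space_C[OF u] by (auto simp: space_PiM PiE_iff split: if_splits)
    then show ?thesis
      using C[of t A] by (subst emeasure_distr[OF meas]) auto
  qed
  \<comment> \<open>The kernel at round \<open>Suc t\<close> reads only the state at time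
    \<open>t\<close>, so the integral over histories collapses to one over the law at time
    \<open>t\<close>.\<close>
  have law: "distr (C 0 (Suc t) ?u) (count_space UNIV) (\<lambda>\<omega>. \<omega> t) = measure_pmf (state_law n E q l0 t)" for t
  proof (induction t)
    case 0
    have "(\<integral>\<^sup>+ \<omega>. emeasure (?K 0 \<omega>) A \<partial>C 0 0 ?u) = emeasure (return_pmf l0) A" for A
      using prob_space.emeasure_space_1[OF prob_space_C[OF u, of 0]]
      by (simp add: game_kernel_def del: C.simps)
    then show ?case
      by (intro measure_eqI) (simp_all add: distr del: C.simps)
  next
    case (Suc t)
    have "?K (Suc t) \<omega> = measure_pmf (next_state n E q (\<omega> t))" for \<omega>
      by (simp add: game_kernel_def)
    then have "(\<integral>\<^sup>+ \<omega>. emeasure (?K (Suc t) \<omega>) A \<partial>C 0 (Suc t) ?u) =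
        (\<integral>\<^sup>+ l. emeasure (next_state n E q l) A \<partial>state_law n E q l0 t)" for A
      unfolding Suc[symmetric] by (subst nn_integral_distr[OF meas]) (auto simp del: C.simps)
    then show ?case
      by (intro measure_eqI) (simp_all add: distr del: C.simps)
  qed
  have emb: "PF.emb {0..<m} {0..<m} (PiE {0..<m} F) = PiE {0..<m} F" for m and F :: "nat \<Rightarrow> state set"
    by (rule prod_emb_id) auto
  have "{\<omega>. \<omega> t \<in> A} = PF.emb UNIV {0..<Suc t} (?S t A)"
    by (auto simp: prod_emb_def PiE_iff split: if_splits)
  then have "emeasure (game_measure n E q l0) {\<omega>. \<omega> t \<in> A} = emeasure (C 0 (Suc t) ?u) (?S t A)"
    unfolding game_measure_def
    by (simp only: lim[OF finite_atLeastLessThan S] emeasure_CI[OF order_refl S] emb)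
  then show ?thesis
    unfolding C distr[symmetric] law .
qed

section \<open>The two-round constant and the combinatorics of available colours\<close>

text \<open>With \<open>h = exp (- 2) / 2\<close> this is the value of
  \<open>exp (- (2 / h)) * (y - h)\<close> at \<open>y = 2 * h\<close>. Here
  \<open>2 * h = exp (- 2)\<close> is a lower bound for the mean fraction of unblocked colours that
  are available one round later, and subtracting only half of it keeps the value positive.\<close>

definition gain :: real where
  "gain = exp (- (4 / exp (- 2))) * (exp (- 2) / 2)"

lemma gain_pos: "0 < gain" and gain_less_1: "gain < 1"
proof -
  have "exp (- (4 / exp (- 2))) * (exp (- 2) / 2) < 1 * (1 :: real)"
    by (intro mult_strict_mono) (auto simp: order_less_trans[of _ 1 2])
  then show "gain < 1"
    by (simp add: gain_def)
qed (simp add: gain_def)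

locale colouring_game =
  fixes n :: nat and E :: "(nat \<times> nat) set" and q :: nat
  assumes graph: "graph_on n E" and enough_colours: "max_degree n E + 2 \<le> q"
begin

abbreviation happy :: "state \<Rightarrow> nat \<Rightarrow> bool" where
  "happy l i \<equiv> payoff E l i = 1"

definition unhappy_neighbours :: "state \<Rightarrow> nat \<Rightarrow> nat set" where
  "unhappy_neighbours l i = {j \<in> neighbours E i. \<not> happy l j}"

text \<open>Neighbours with payoff 1 keep their colour, so this set contains every colour that can
  be available to \<open>i\<close> one round later.\<close>

definition unblocked :: "state \<Rightarrow> nat \<Rightarrow> nat set" where
  "unblocked l i = {1..q} - l ` {j \<in> neighbours E i. happy l j}"

lemma neighbours_subset: "neighbours E i \<subseteq> {1..n}"
  using graph by (auto simp: graph_on_def neighbours_def)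

lemma neighbours_le: "j \<in> neighbours E i \<Longrightarrow> 1 \<le> j \<and> j \<le> n"
  using neighbours_subset by fastforce

lemma finite_neighbours: "finite (neighbours E i)"
  using neighbours_subset by (rule finite_subset) simp

lemma neighbours_sym: "j \<in> neighbours E i \<Longrightarrow> i \<in> neighbours E j"
  using graph by (auto simp: graph_on_def neighbours_def dest: symD)

lemma not_neighbour_self: "i \<notin> neighbours E i"
  using graph by (auto simp: graph_on_def neighbours_def irrefl_def)

lemma degree_add_2_le: "card (neighbours E i) + 2 \<le> q"
proof (cases "i \<in> {1..n}")
  case True
  then have "card (neighbours E i) \<le> max_degree n E"
    unfolding max_degree_def by (intro Max_ge) auto
  then show ?thesis
    using enough_colours by linarith
next
  case False
  then have "neighbours E i = {}"
    using neighbours_subset neighbours_sym by blast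
  then show ?thesis
    using enough_colours by simp
qed

lemma finite_available: "finite (available E q l i)"
  by (simp add: available_def)

text \<open>Two spare colours beyond the degree ensure that a player with payoff 0 picks any given
  colour with probability at most \<open>1/2\<close>, the range in which
  \<open>one_minus_ge_exp\<close> applies.\<close>

lemma card_available_ge: "2 \<le> card (available E q l i)"
proof -
  have "card {1..q} - card (l ` neighbours E i) \<le> card (available E q l i)"
    unfolding available_def by (intro diff_card_le_card_Diff) (simp add: finite_neighbours)
  moreover have "card (l ` neighbours E i) \<le> card (neighbours E i)"
    by (intro card_image_le finite_neighbours)
  ultimately show ?thesis
    using degree_add_2_le[of i] by simp
qed

lemma available_nonempty: "available E q l i \<noteq> {}"
  using card_available_ge[of l i] by auto

lemma finite_unblocked: "finite (unblocked l i)"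
  by (simp add: unblocked_def)

text \<open>Each neighbour with payoff 1 blocks at most one colour, so the surplus of colours over
  neighbours survives when these neighbours are discarded. The resulting ratio below 1 is the source
  of the constant \<open>exp (- 2)\<close>.\<close>

lemma card_unhappy_neighbours_less: "card (unhappy_neighbours l i) < card (unblocked l i)"
proof -
  let ?H = "{j \<in> neighbours E i. happy l j}"
  have "card {1..q} - card (l ` ?H) \<le> card (unblocked l i)"
    unfolding unblocked_def by (intro diff_card_le_card_Diff) (simp add: finite_neighbours)
  moreover have "card (l ` ?H) \<le> card ?H"
    by (intro card_image_le) (simp add: finite_neighbours)
  moreover have "card (neighbours E i) = card ?H + card (unhappy_neighbours l i)"
    unfolding unhappy_neighbours_def
    by (subst card_Un_disjoint[symmetric]) (auto simp: finite_neighbours intro: arg_cong[where f = card])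
  ultimately show ?thesis
    using degree_add_2_le[of i] by simp
qed

lemma next_state_cases:
  assumes "l' \<in> set_pmf (next_state n E q l)" "i \<in> {1..n}"
  shows "happy l i \<and> l' i = l i \<or> \<not> happy l i \<and> l' i \<in> available E q l i"
proof -
  have "l' i \<in> set_pmf (next_colour E q l i)"
    using assms by (auto simp: next_state_def set_Pi_pmf PiE_dflt_def)
  then show ?thesis
    by (auto simp: next_colour_def set_pmf_of_set[OF available_nonempty finite_available]
        split: if_splits)
qed

text \<open>A neighbour that keeps its colour differs from \<open>l i\<close> already, and one that
  moves avoids \<open>l i\<close> because \<open>i\<close> is among its own neighbours. As
  \<open>i\<close> does not move, no conflict can arise.\<close>

lemma happy_persists:
  assumes l': "l' \<in> set_pmf (next_state n E q l)" and i: "i \<in> {1..n}" "happy l i"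
  shows "happy l' i"
proof -
  have "l' i = l i"
    using next_state_cases[OF l' i(1)] i(2) by auto
  moreover have "l' j \<noteq> l i" if j: "j \<in> neighbours E i" for j
  proof -
    have "j \<in> {1..n}"
      using j neighbours_le by auto
    moreover have "l i \<noteq> l j"
      using i(2) j by (simp add: payoff_def split: if_splits)
    moreover have "l i \<in> l ` neighbours E j"
      using neighbours_sym[OF j] by simp
    ultimately show ?thesis
      using next_state_cases[OF l', of j] unfolding available_def by fastforce
  qed
  ultimately show ?thesis
    by (simp add: payoff_def) metis
qed

section \<open>Probability bounds for one and two rounds and their iteration\<close>

lemma pmf_next_colour_unhappy_le:
  assumes "\<not> happy l j"
  shows "pmf (next_colour E q l j) x \<le> 1/2"
proof -
  have "1 / real (card (available E q l j)) \<le> 1/2"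
    using card_available_ge[of l j] by (simp add: field_simps)
  then show ?thesis
    using assms
    by (simp add: next_colour_def pmf_of_set[OF available_nonempty finite_available] split: split_indicator)
qed

text \<open>Neighbours with payoff 1 put no mass on unblocked colours, and each other neighbour
  spreads total mass at most 1 over \<open>X\<close>. Hence the Jensen bound applies with the number
  of unhappy neighbours as total mass.\<close>

lemma sum_prod_avoid_ge:
  assumes X: "finite X" "X \<noteq> {}" "X \<subseteq> unblocked l i"
  shows "card X * exp (- (2 * real (card (unhappy_neighbours l i)) / card X)) \<le>
    (\<Sum>x\<in>X. \<Prod>j\<in>neighbours E i. 1 - pmf (next_colour E q l j) x)"
proof (rule sum_prod_one_minus_ge)
  let ?p = "\<lambda>j x. pmf (next_colour E q l j) x"
  have happy_0: "?p j x = 0" if "j \<in> neighbours E i" "x \<in> X" "happy l j" for j x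
    using that X(3) by (auto simp: next_colour_def unblocked_def indicator_def)
  show "0 \<le> ?p j x \<and> ?p j x \<le> 1/2" if "j \<in> neighbours E i" "x \<in> X" for j x
    using that happy_0[of j x] pmf_next_colour_unhappy_le[of l j x] by (cases "happy l j") auto
  have "(\<Sum>x\<in>X. \<Sum>j\<in>neighbours E i. ?p j x) = (\<Sum>j\<in>neighbours E i. \<Sum>x\<in>X. ?p j x)"
    by (rule sum.swap)
  also have "\<dots> = (\<Sum>j\<in>unhappy_neighbours l i. \<Sum>x\<in>X. ?p j x)"
    using happy_0 by (intro sum.mono_neutral_right) (auto simp: finite_neighbours unhappy_neighbours_def)
  also have "\<dots> \<le> (\<Sum>j\<in>unhappy_neighbours l i. 1)"
    by (intro sum_mono) (simp add: measure_measure_pmf_finite[symmetric] X)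
  finally show "(\<Sum>x\<in>X. \<Sum>j\<in>neighbours E i. ?p j x) \<le> real (card (unhappy_neighbours l i))"
    by simp
qed (use X finite_neighbours in auto)

lemma prob_neighbours_avoid:
  "measure_pmf.prob (next_state n E q l) {l'. \<forall>j\<in>neighbours E i. l' j \<noteq> x} =
    (\<Prod>j\<in>neighbours E i. 1 - pmf (next_colour E q l j) x)"
proof -
  let ?F = "\<lambda>j. if j \<in> neighbours E i then - {x} else UNIV"
  have "{l'. \<forall>j\<in>neighbours E i. l' j \<noteq> x} = Pi {1..n} ?F"
    using neighbours_le by (fastforce simp: Pi_iff split: if_splits)
  then have "measure_pmf.prob (next_state n E q l) {l'. \<forall>j\<in>neighbours E i. l' j \<noteq> x} =
      (\<Prod>j\<in>{1..n}. measure_pmf.prob (next_colour E q l j) (?F j))"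
    by (simp add: next_state_def measure_Pi_pmf_Pi)
  also have "\<dots> = (\<Prod>j\<in>neighbours E i. measure_pmf.prob (next_colour E q l j) (?F j))"
    using neighbours_subset[of i] by (intro prod.mono_neutral_right) auto
  also have "\<dots> = (\<Prod>j\<in>neighbours E i. 1 - pmf (next_colour E q l j) x)"
    by (intro prod.cong) (auto simp: prob_Compl_singleton)
  finally show ?thesis .
qed

text \<open>\<open>i\<close> is not its own neighbour, so all constraints concern different
  coordinates and independence gives a product.\<close>

lemma prob_choose_and_neighbours_avoid:
  assumes i: "i \<in> {1..n}"
  shows "measure_pmf.prob (next_state n E q l) {l'. l' i = x \<and> (\<forall>j\<in>neighbours E i. l' j \<noteq> x)} =
    pmf (next_colour E q l i) x * (\<Prod>j\<in>neighbours E i. 1 - pmf (next_colour E q l j) x)"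
proof -
  let ?F = "\<lambda>j. if j = i then {x} else if j \<in> neighbours E i then - {x} else UNIV"
  let ?N = "insert i (neighbours E i)"
  have "{l'. l' i = x \<and> (\<forall>j\<in>neighbours E i. l' j \<noteq> x)} = Pi {1..n} ?F"
    using neighbours_le not_neighbour_self[of i] i by (fastforce simp: Pi_iff split: if_splits)
  then have "measure_pmf.prob (next_state n E q l) {l'. l' i = x \<and> (\<forall>j\<in>neighbours E i. l' j \<noteq> x)} =
      (\<Prod>j\<in>{1..n}. measure_pmf.prob (next_colour E q l j) (?F j))"
    by (simp add: next_state_def measure_Pi_pmf_Pi)
  also have "\<dots> = (\<Prod>j\<in>?N. measure_pmf.prob (next_colour E q l j) (?F j))"
    using neighbours_subset[of i] i by (intro prod.mono_neutral_right) auto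
  also have "\<dots> = pmf (next_colour E q l i) x *
      (\<Prod>j\<in>neighbours E i. measure_pmf.prob (next_colour E q l j) (?F j))"
    by (subst prod.insert) (auto simp: finite_neighbours not_neighbour_self measure_pmf_single)
  also have "(\<Prod>j\<in>neighbours E i. measure_pmf.prob (next_colour E q l j) (?F j)) =
      (\<Prod>j\<in>neighbours E i. 1 - pmf (next_colour E q l j) x)"
    using not_neighbour_self[of i]
    by (intro prod.cong) (auto simp: prob_Compl_singleton)
  finally show ?thesis .
qed

text \<open>The events are split by the colour \<open>x\<close> chosen by \<open>i\<close>. They are
  disjoint and the choice is uniform, so their total probability is the average over the available
  colours of the probability that no neighbour takes \<open>x\<close>.\<close>

lemma prob_happy_next_ge:
  assumes i: "i \<in> {1..n}" and unhappy: "\<not> happy l i"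
  shows "exp (- (2 * real (card (unhappy_neighbours l i)) / card (available E q l i))) \<le>
    measure_pmf.prob (next_state n E q l) {l'. happy l' i}"
proof -
  let ?A = "available E q l i"
  let ?ev = "\<lambda>x. {l'. l' i = x \<and> (\<forall>j\<in>neighbours E i. l' j \<noteq> x)}"
  have A: "real (card ?A) > 0"
    using card_available_ge[of l i] by simp
  have "card ?A * exp (- (2 * real (card (unhappy_neighbours l i)) / card ?A)) \<le>
      (\<Sum>x\<in>?A. \<Prod>j\<in>neighbours E i. 1 - pmf (next_colour E q l j) x)"
    by (intro sum_prod_avoid_ge finite_available available_nonempty)
       (auto simp: available_def unblocked_def)
  then have "exp (- (2 * real (card (unhappy_neighbours l i)) / card ?A)) \<le>
      (\<Sum>x\<in>?A. \<Prod>j\<in>neighbours E i. 1 - pmf (next_colour E q l j) x) / card ?A"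
    using A by (simp add: pos_le_divide_eq mult.commute)
  also have "\<dots> = (\<Sum>x\<in>?A. measure_pmf.prob (next_state n E q l) (?ev x))"
    using unhappy unfolding sum_divide_distrib
    by (intro sum.cong) (auto simp: prob_choose_and_neighbours_avoid[OF i] next_colour_def
        pmf_of_set[OF available_nonempty finite_available])
  also have "\<dots> = measure_pmf.prob (next_state n E q l) (\<Union>x\<in>?A. ?ev x)"
    by (intro measure_pmf.finite_measure_finite_Union[symmetric])
       (auto simp: finite_available disjoint_family_on_def)
  also have "\<dots> \<le> measure_pmf.prob (next_state n E q l) {l'. happy l' i}"
    by (intro measure_pmf.finite_measure_mono) (auto simp: payoff_def)
  finally show ?thesis .
qed

lemma card_available_le: "card (available E q l i) \<le> q"
  using card_mono[of "{1..q}" "available E q l i"] by (auto simp: available_def)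

lemma integrable_card_available:
  "integrable (measure_pmf p) (\<lambda>l. real (card (available E q l i)))"
  using card_available_le by (intro measure_pmf.integrable_const_bound[where B = q]) auto

text \<open>Linearity of expectation: an unblocked colour is available after the round exactly when
  no neighbour then holds it, and the sum of these probabilities is bounded by Jensen. The present
  number of available colours does not enter.\<close>

lemma expected_card_available_ge:
  "real (card (unblocked l i)) * exp (- 2) \<le> (\<integral>l'. real (card (available E q l' i)) \<partial>measure_pmf (next_state n E q l))"
proof -
  let ?B = "unblocked l i" and ?u = "card (unhappy_neighbours l i)"
  let ?ev = "\<lambda>x. {l'. \<forall>j\<in>neighbours E i. l' j \<noteq> x}"
  have u: "?u < card ?B"
    by (rule card_unhappy_neighbours_less)
  then have "card ?B * exp (- 2) \<le> card ?B * exp (- (2 * real ?u / card ?B))"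
    by (intro mult_left_mono) (auto simp: field_simps)
  also have "\<dots> \<le> (\<Sum>x\<in>?B. \<Prod>j\<in>neighbours E i. 1 - pmf (next_colour E q l j) x)"
    using u by (intro sum_prod_avoid_ge finite_unblocked) auto
  also have "\<dots> = (\<Sum>x\<in>?B. \<integral>l'. indicator (?ev x) l' \<partial>measure_pmf (next_state n E q l))"
    by (simp add: prob_neighbours_avoid)
  also have "\<dots> = (\<integral>l'. (\<Sum>x\<in>?B. indicator (?ev x) l') \<partial>measure_pmf (next_state n E q l))"
    by (intro Bochner_Integration.integral_sum[symmetric]) (rule integrable_measure_pmf_indicator)
  also have "\<dots> \<le> (\<integral>l'. real (card (available E q l' i)) \<partial>measure_pmf (next_state n E q l))"
  proof (rule integral_mono)
    fix l'
    have "(\<Sum>x\<in>?B. indicator (?ev x) l') = real (card (?B \<inter> {x. l' \<in> ?ev x}))"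
      by (simp add: indicator_def finite_unblocked sum.If_cases)
    also have "\<dots> \<le> card (available E q l' i)"
      by (intro of_nat_mono card_mono finite_available) (auto simp: available_def unblocked_def)
    finally show "(\<Sum>x\<in>?B. indicator (?ev x) l') \<le> real (card (available E q l' i))" .
  qed (auto intro!: integrable_card_available integrable_sum integrable_measure_pmf_indicator)
  finally show ?thesis .
qed

text \<open>
  The lower bound is an affine minorant of \<open>\<lambda>y. exp (- 2 / y)\<close> on \<open>{0<..1}\<close>, with value \<open>gain\<close> at
  \<open>y = exp (- 2)\<close>; being affine, it can be averaged over the first of two rounds.
\<close>

lemma prob_happy_second_round_ge:
  assumes i: "i \<in> {1..n}" and l': "l' \<in> set_pmf (next_state n E q l)"
  shows "exp (- (4 / exp (- 2))) * (card (available E q l' i) / card (unblocked l i) - exp (- 2) / 2) \<le>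
    measure_pmf.prob (next_state n E q l') {l''. happy l'' i}"
proof -
  define y where "y = card (available E q l' i) / card (unblocked l i)"
  define h :: real where "h = exp (- 2) / 2"
  have h: "h > 0" "4 / exp (- 2) = 2 / h"
    by (auto simp: h_def)
  have B: "real (card (unblocked l i)) > 0"
    using card_unhappy_neighbours_less[of l i] by simp
  have A: "real (card (available E q l' i)) > 0"
    using card_available_ge[of l' i] by simp
  have "available E q l' i \<subseteq> unblocked l i"
  proof
    fix x assume x: "x \<in> available E q l' i"
    have "x \<noteq> l j" if j: "j \<in> neighbours E i" "happy l j" for j
    proof -
      have "j \<in> {1..n}"
        using j(1) neighbours_le by auto
      from next_state_cases[OF l' this] have "l' j = l j"
        using j(2) by auto
      then show ?thesis
        using x j(1) by (force simp: available_def)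
    qed
    then show "x \<in> unblocked l i"
      using x by (auto simp: available_def unblocked_def)
  qed
  then have y: "0 < y" "y \<le> 1"
    using A B by (auto simp: y_def intro!: card_mono finite_unblocked)
  have "unhappy_neighbours l' i \<subseteq> unhappy_neighbours l i"
    using happy_persists[OF l'] neighbours_le by (auto simp: unhappy_neighbours_def)
  then have "card (unhappy_neighbours l' i) \<le> card (unhappy_neighbours l i)"
    by (intro card_mono) (auto simp: unhappy_neighbours_def finite_neighbours)
  then have u: "card (unhappy_neighbours l' i) \<le> card (unblocked l i)"
    using card_unhappy_neighbours_less[of l i] by simp
  have "exp (- (2 / h)) * (y - h) \<le> measure_pmf.prob (next_state n E q l') {l''. happy l'' i}"
  \<comment> \<open>Below \<open>h\<close> the affine bound is negative. From \<open>h\<close> on,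
    \<open>y - h <= 1\<close> and \<open>exp (- (2 / h)) <= exp (- (2 / y))\<close>.\<close>
  proof (cases "y < h")
    case True
    then have "exp (- (2 / h)) * (y - h) \<le> 0"
      by (intro mult_nonneg_nonpos) auto
    then show ?thesis
      using measure_nonneg order_trans by blast
  next
    case False
    have "exp (- (2 / h)) * (y - h) \<le> exp (- (2 / h)) * 1"
      using y h by (intro mult_left_mono) auto
    also have "\<dots> \<le> exp (- (2 / y))"
      using False h y by (simp add: field_simps)
    also have "\<dots> \<le> measure_pmf.prob (next_state n E q l') {l''. happy l'' i}"
    proof (cases "happy l' i")
      case True
      then have "AE l'' in next_state n E q l'. l'' \<in> {l''. happy l'' i}"
        using happy_persists[OF _ i] by (auto simp: AE_measure_pmf_iff)
      then have "measure_pmf.prob (next_state n E q l') {l''. happy l'' i} = 1"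
        by (subst measure_pmf.prob_eq_1) auto
      then show ?thesis
        using y by simp
    next
      case False
      \<comment> \<open>The unhappy neighbours in \<open>l'\<close> number at most
        \<open>card (unblocked l i)\<close>, so the exponent of the one-round bound is controlled by
        \<open>y\<close> alone.\<close>
      have "2 * real (card (unhappy_neighbours l' i)) / card (available E q l' i) \<le> 2 / y"
        using u A B by (simp add: y_def divide_right_mono)
      then have "exp (- (2 / y)) \<le>
          exp (- (2 * real (card (unhappy_neighbours l' i)) / card (available E q l' i)))"
        by simp
      also note prob_happy_next_ge[OF i False]
      finally show ?thesis .
    qed
    finally show ?thesis .
  qed
  then show ?thesis
    by (simp add: y_def h_def)
qed

lemma prob_happy_after_two_rounds_ge:
  assumes i: "i \<in> {1..n}"
  shows "gain \<le> measure_pmf.prob (bind_pmf (next_state n E q l) (next_state n E q)) {l'. happy l' i}"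
proof -
  let ?B = "card (unblocked l i)" and ?e = "exp (- (4 / exp (- 2))) :: real"
  have B: "real ?B > 0"
    using card_unhappy_neighbours_less[of l i] by simp
  have "exp (- 2) \<le> (\<integral>l'. real (card (available E q l' i)) \<partial>measure_pmf (next_state n E q l)) / ?B"
    using expected_card_available_ge[of l i] B by (simp add: field_simps)
  then have "gain \<le> ?e * ((\<integral>l'. real (card (available E q l' i)) \<partial>measure_pmf (next_state n E q l)) / ?B - exp (- 2) / 2)"
    unfolding gain_def by (intro mult_left_mono) (linarith, simp)
  also have "\<dots> = (\<integral>l'. ?e * (card (available E q l' i) / ?B - exp (- 2) / 2) \<partial>measure_pmf (next_state n E q l))"
    by (simp add: integrable_card_available Bochner_Integration.integral_diff)
  \<comment> \<open>The second-round bound is known only for states reachable in one round, hence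
    monotonicity almost everywhere.\<close>
  also have "\<dots> \<le> (\<integral>l'. measure_pmf.prob (next_state n E q l') {l''. happy l'' i} \<partial>measure_pmf (next_state n E q l))"
    using prob_happy_second_round_ge[OF i]
    by (intro integral_mono_AE)
       (auto simp: AE_measure_pmf_iff integrable_card_available integrable_measure_pmf_prob)
  finally show ?thesis
    by (simp add: measure_bind_pmf_eq_integral)
qed

text \<open>The indicator, justified by persistence of payoff 1, makes the bound iterate:
  integrating it over the current law yields a recursion for the probability of payoff 0.\<close>

lemma prob_unhappy_after_two_rounds_le:
  assumes i: "i \<in> {1..n}"
  shows "measure_pmf.prob (bind_pmf (next_state n E q l) (next_state n E q)) {l'. \<not> happy l' i} \<le>
    (1 - gain) * indicator {l. \<not> happy l i} l"
proof (cases "happy l i")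
  case True
  then have "set_pmf (bind_pmf (next_state n E q l) (next_state n E q)) \<inter> {l'. \<not> happy l' i} = {}"
    using happy_persists i by auto
  then show ?thesis
    using True by (simp add: measure_pmf_zero_iff[THEN iffD2])
next
  case False
  have "{l'. \<not> happy l' i} = UNIV - {l'. happy l' i}"
    by auto
  then show ?thesis
    using False prob_happy_after_two_rounds_ge[OF i, of l] measure_pmf.prob_compl[of "{l'. happy l' i}"]
    by simp
qed

text \<open>Two rounds contract by \<open>1 - gain = s ^ 4\<close>, that is by \<open>s^2\<close>
  per round. Induction in steps of two needs the base cases 0 and 1; the prefactor
  \<open>1 / s^2\<close> makes the bound at least 1 in the first and exactly 1 in the
  second.\<close>

lemma prob_unhappy_le:
  assumes i: "i \<in> {1..n}" and s: "0 < s" "s < 1" "s ^ 4 = 1 - gain"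
  shows "measure_pmf.prob (state_law n E q l0 t) {l. \<not> happy l i} \<le> (s\<^sup>2) ^ t / s\<^sup>2"
proof (induction t rule: induct_nat_012)
  case 0
  have "1 \<le> 1 / s\<^sup>2"
    using s by (simp add: power_le_one)
  then show ?case
    using measure_pmf.prob_le_1[of "state_law n E q l0 0" "{l. \<not> happy l i}"] 
    by (simp only: power_0)
next
  case 1
  show ?case
    using s by simp
next
  case (ge2 t)
  let ?p = "state_law n E q l0"
  have "measure_pmf.prob (?p (Suc (Suc t))) {l. \<not> happy l i} =
      (\<integral>l. measure_pmf.prob (bind_pmf (next_state n E q l) (next_state n E q)) {l. \<not> happy l i}
        \<partial>measure_pmf (?p t))"
    by (simp only: state_law.simps bind_assoc_pmf measure_bind_pmf_eq_integral[of "?p t"])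
  also have "\<dots> \<le> (\<integral>l. (1 - gain) * indicator {l. \<not> happy l i} l \<partial>measure_pmf (?p t))"
    by (intro integral_mono prob_unhappy_after_two_rounds_le i)
       (auto simp: integrable_measure_pmf_prob integrable_measure_pmf_indicator)
  also have "\<dots> = s ^ 4 * measure_pmf.prob (?p t) {l. \<not> happy l i}"
    by (simp add: s)
  also have "\<dots> \<le> s ^ 4 * ((s\<^sup>2) ^ t / s\<^sup>2)"
    using s(1) by (intro mult_left_mono ge2 zero_le_power) simp
  also have "\<dots> = (s\<^sup>2) ^ Suc (Suc t) / s\<^sup>2"
    by (simp add: power4_eq_xxxx power2_eq_square)
  finally show ?case .
qed

lemma prob_not_converged_le:
  assumes s: "0 < s" "s < 1" "s ^ 4 = 1 - gain"
  shows "measure (game_measure n E q l0) {\<omega>. \<not> converged n E (\<omega> t)} \<le> 1 / s\<^sup>2 * n * (s\<^sup>2) ^ t"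
proof -
  have "measure (game_measure n E q l0) {\<omega>. \<not> converged n E (\<omega> t)} =
      measure_pmf.prob (state_law n E q l0 t) {l. \<not> converged n E l}"
    using emeasure_game_measure_state[of n E q l0 t "{l. \<not> converged n E l}"] by (simp add: measure_def)
  also have "{l. \<not> converged n E l} = (\<Union>i\<in>{1..n}. {l. \<not> happy l i})"
    by (auto simp: converged_def)
  also have "measure_pmf.prob (state_law n E q l0 t) \<dots> \<le>
      (\<Sum>i\<in>{1..n}. measure_pmf.prob (state_law n E q l0 t) {l. \<not> happy l i})"
    by (intro measure_pmf.finite_measure_subadditive_finite) auto
  also have "\<dots> \<le> (\<Sum>i\<in>{1..n}. (s\<^sup>2) ^ t / s\<^sup>2)"
    by (intro sum_mono prob_unhappy_le s)
  finally show ?thesis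
    by simp
qed

end

lemma measurable_game_state[measurable]:
  "(\<lambda>\<omega>. \<omega> t) \<in> measurable (game_measure n E q l0) (count_space UNIV)"
  unfolding measurable_cong_sets[OF sets_game_measure refl]
  by (rule measurable_component_singleton) simp

lemma measurable_not_converged: "{\<omega>. \<not> converged n E (\<omega> t)} \<in> sets (game_measure n E q l0)"
proof -
  have "(\<lambda>\<omega>. \<omega> t) -` {l. \<not> converged n E l} \<inter> space (game_measure n E q l0) \<in> sets (game_measure n E q l0)"
    by (rule measurable_sets[OF measurable_game_state]) simp
  then show ?thesis
    by (simp add: space_game_measure vimage_def)
qed

lemma measurable_convergence_time[measurable]:
  "convergence_time n E \<in> measurable (game_measure n E q l0) (count_space UNIV)"
proof -
  have "(\<lambda>\<omega>. LEAST t. converged n E (\<omega> t)) \<in> measurable (game_measure n E q l0) (count_space UNIV)"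
    by (intro measurable_Least measurable_compose[OF measurable_game_state]) simp
  then show ?thesis
    by (simp add: convergence_time_def[abs_def])
qed

theorem theorem2:
  shows "\<exists>D::real. D > 0 \<and> (\<forall>n\<ge>2. \<forall>E q l0.
     graph_on n E \<and> q \<ge> max_degree n E + 2 \<and> l0 \<in> {1..n} \<rightarrow> {1..q} \<longrightarrow>
       (let M = game_measure n E q l0; T = (\<lambda>\<omega>. real (convergence_time n E \<omega>)) in
          (AE \<omega> in M. \<exists>t. converged n E (\<omega> t)) \<and>
          integrable M T \<and> integrable M (\<lambda>\<omega>. (T \<omega>)\<^sup>2) \<and>
          prob_space.variance M T \<le> D * (ln (real n))\<^sup>2))"
proof -
  \<comment> \<open>One square root passes from two rounds to one, the other leaves room for the
    exponential moment.\<close>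
  define s where "s = sqrt (sqrt (1 - gain))"
  have "s ^ 4 = (s\<^sup>2)\<^sup>2"
    by (simp flip: power_mult)
  then have s: "0 < s" "s < 1" "s ^ 4 = 1 - gain"
    using gain_pos gain_less_1 by (auto simp: s_def)
  \<comment> \<open>The constant of \<open>variance_le_log_square\<close> for
    \<open>C = 1 / s^2\<close>, the prefactor of the tail bound.\<close>
  define D where "D = 2 / (ln s)\<^sup>2 + 4 / (ln s)\<^sup>2 * (1 + 1 / s\<^sup>2 / s) / (ln 2)\<^sup>2"
  have "D > 0"
    using s by (auto simp: D_def intro!: add_pos_nonneg mult_nonneg_nonneg)
  moreover have "(AE \<omega> in M. \<exists>t. converged n E (\<omega> t)) \<and> integrable M T \<and>
      integrable M (\<lambda>\<omega>. (T \<omega>)\<^sup>2) \<and> prob_space.variance M T \<le> D * (ln (real n))\<^sup>2"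
    if "n \<ge> 2" "graph_on n E" "q \<ge> max_degree n E + 2"
      and M: "M = game_measure n E q l0" and T: "T = (\<lambda>\<omega>. real (convergence_time n E \<omega>))"
    for n E q l0 M T
  proof -
    interpret colouring_game n E q
      using that by unfold_locales
    interpret M: prob_space M
      unfolding M by (rule prob_space_game_measure)
    have not_conv: "M.prob {\<omega>. \<not> converged n E (\<omega> t)} \<le> 1 / s\<^sup>2 * n * (s\<^sup>2) ^ t" for t
      unfolding M by (rule prob_not_converged_le[OF s])
    have tail: "M.prob {\<omega> \<in> space M. t < convergence_time n E \<omega>} \<le> 1 / s\<^sup>2 * n * (s\<^sup>2) ^ t" for t
    proof -
      \<comment> \<open>This inclusion also covers plays that never converge, whatever value
        \<open>LEAST\<close> takes on them.\<close>
      have "{\<omega> \<in> space M. t < convergence_time n E \<omega>} \<subseteq> {\<omega>. \<not> converged n E (\<omega> t)}"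
        by (auto simp: convergence_time_def dest: not_less_Least)
      then show ?thesis
        using M.finite_measure_mono[OF _ measurable_not_converged[of n E t q l0, folded M]] not_conv[of t]
        by (meson order_trans)
    qed
    have "AE \<omega> in M. \<exists>t. converged n E (\<omega> t)"
    proof -
      \<comment> \<open>The event of never converging lies in every event of not having converged at
        time \<open>t\<close>, whose probabilities tend to 0.\<close>
      let ?F = "\<Inter>t. {\<omega>. \<not> converged n E (\<omega> t)}"
      have F: "?F \<in> sets M"
        unfolding M using measurable_not_converged by auto
      have "(\<lambda>t. 1 / s\<^sup>2 * n * (s\<^sup>2) ^ t) \<longlonglongrightarrow> 1 / s\<^sup>2 * n * 0"
        using s by (intro tendsto_mult tendsto_const LIMSEQ_power_zero) (simp add: abs_square_less_1)
      moreover have "M.prob ?F \<le> 1 / s\<^sup>2 * n * (s\<^sup>2) ^ t" for t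
        using M.finite_measure_mono[OF _ measurable_not_converged[of n E t q l0, folded M], of ?F] not_conv[of t]
        by (meson INT_lower UNIV_I order_trans)
      ultimately have "M.prob ?F \<le> 1 / s\<^sup>2 * n * 0"
        by (intro LIMSEQ_le_const) auto
      then have "?F \<in> null_sets M"
        using F by (auto simp: null_sets_def M.emeasure_eq_measure measure_le_0_iff)
      then show ?thesis
        by (rule AE_I') auto
    qed
    moreover have "convergence_time n E \<in> measurable M (count_space UNIV)"
      unfolding M by (rule measurable_convergence_time)
    ultimately show ?thesis
      using variance_le_log_square[OF M.prob_space_axioms _ s(1,2) _ _ tail] s(1) that(1)
      by (simp add: T D_def)
  qed
  ultimately show ?thesis
    by (auto simp: Let_def intro!: exI[of _ D])
qed

end
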